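(* Let $Q$ be a smooth manifold of dimension $N$ with local coordinates $x=(x^1,\dots,x^N)$, $\partial_k=\partial/\partial x^k$, equipped with a Riemannian metric $G=(G_{kj}(x))$. Let $\Omega_j=\sum_{k=1}^N\alpha_{jk}(x)\,dx^k$, $j=1,\dots,M$ ($M<N$), be given smooth 1-forms, and let $\Omega_{M+1},\dots,\Omega_N$ be arbitrary smooth 1-forms such that $\Upsilon=(\Omega_1\wedge\dots\wedge\Omega_N)(\partial_1,\dots,\partial_N)\neq0$. Let $\lambda_{M+1},\dots,\lambda_N$ be arbitrary smooth functions on $Q$ and let $\mathbf v$ be the vector field $$\mathbf v=\frac1\Upsilon\left|\begin{array}{cccc}\Omega_1(\partial_1)&\cdots&\Omega_1(\partial_N)&0\\ \vdots&&\vdots&\vdots\\ \Omega_M(\partial_1)&\cdots&\Omega_M(\partial_N)&0\\ \Omega_{M+1}(\partial_1)&\cdots&\Omega_{M+1}(\partial_N)&\lambda_{M+1}\\ \vdots&&\vdots&\vdots\\ \Omega_N(\partial_1)&\cdots&\Omega_N(\partial_N)&\lambda_N\\ \partial_1&\cdots&\partial_N&0\end{array}\right| .$$ Let $\sigma=\sum_{j,k=1}^N G_{kj}v^k\,dx^j$ be the 1-form associated to $\mathbf v$. Write $d\sigma=\frac12\sum_{j,k=1}^N a_{jk}\,\Omega_j\wedge\Omega_k$ with $A=(a_{jk})$ skew-symmetric, so that $H=\mathcal M^TA\mathcal M$ with $H=(d\sigma(\partial_j,\partial_k))$ and $\mathcal M=(\Omega_j(\partial_k))$. Write $\iota_{\mathbf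 v}d\sigma=\sum_{j=1}^N\Lambda_j\Omega_j$, where $\Lambda=(\Lambda_1,\dots,\Lambda_N)^T$ is given by $$\Lambda=A\tilde\lambda=(\mathcal M^T)^{-1}\tau ,\qquad \tilde\lambda=(0,\dots,0,\lambda_{M+1},\dots,\lambda_N)^T,\quad \tau=(\iota_{\mathbf v}d\sigma(\partial_1),\dots,\iota_{\mathbf v}d\sigma(\partial_N))^T .$$ Then, under the conditions $\Lambda_j(x)=0$ for $j=M+1,\dots,N$, the first order system $\dot{\mathbf x}=\mathbf v(x)$ on $Q$ is an invariant relation of the second order system $$\frac{d}{dt}\frac{\partial T}{\partial\dot x^k}-\frac{\partial T}{\partial x^k}=\frac{\partial}{\partial x^k}\Big(\tfrac12\|\mathbf v\|^2\Big)+\sum_{j=1}^M\Lambda_j\alpha_{jk},\qquad k=1,\dots,N ,$$ that is, every solution of $\dot{\mathbf x}=\mathbf v(x)$ is a solution of this second order system.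
   Context: The determinant with vector fields $\partial_1,\dots,\partial_N$ in the last row is the formal expansion along that row. $T=\frac12\|\dot{\mathbf x}\|^2=\frac12\sum_{j,k}G_{jk}(x)\dot x^j\dot x^k$ is the kinetic energy, $\|\mathbf v\|^2=\sum_{j,k}G_{jk}v^jv^k$, and $\iota_{\mathbf v}$ denotes contraction with $\mathbf v$ in the first slot. The wedge product is normalized so that $(\alpha\wedge\beta)(u,w)=\alpha(u)\beta(w)-\alpha(w)\beta(u)$ for 1-forms, so $\Upsilon=\det(\Omega_j(\partial_k))$. All data are of class $C^\infty$. The conditions $\Lambda_j=0$ are required identically on $Q$. *)

theory Defs
  imports "HOL-Analysis.Analysis"
begin

section \<open>Smooth maps between Euclidean spaces\<close>

text \<open>Both notions are meant for an open set \<open>S\<close>.\<close>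

primrec Ck_on :: "nat \<Rightarrow> 'a::euclidean_space set \<Rightarrow> ('a \<Rightarrow> 'b::euclidean_space) \<Rightarrow> bool" where
  "Ck_on 0 S f \<longleftrightarrow> continuous_on S f"
| "Ck_on (Suc r) S f \<longleftrightarrow>
     f differentiable_on S \<and> (\<forall>h. Ck_on r S (\<lambda>x. frechet_derivative f (at x) h))"

definition smooth_on :: "'a::euclidean_space set \<Rightarrow> ('a \<Rightarrow> 'b::euclidean_space) \<Rightarrow> bool" where
  "smooth_on S f \<longleftrightarrow> (\<forall>r. Ck_on r S f)"

definition partial_deriv :: "'n::finite \<Rightarrow> (real^'n \<Rightarrow> real) \<Rightarrow> real^'n \<Rightarrow> real" where
  "partial_deriv k f x = frechet_derivative f (at x) (axis k 1)"


section \<open>Smooth manifolds in local coordinates\<close>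

text \<open>The manifold is a whole type \<open>'q\<close>, which is Hausdorff and second countable by its type
  class; its dimension is \<open>CARD('n)\<close>. A chart is a coordinate domain together with its coordinate
  map, whose values outside the domain are irrelevant. The atlas need not be maximal, but it may be.\<close>

type_synonym ('q, 'n) chart = "'q set \<times> ('q \<Rightarrow> real^'n)"

definition chart_dom :: "('q, 'n) chart \<Rightarrow> 'q set" where
  "chart_dom c = fst c"

definition coord :: "('q, 'n) chart \<Rightarrow> 'q \<Rightarrow> real^'n" where
  "coord c = snd c"

definition chart_ran :: "('q, 'n) chart \<Rightarrow> (real^'n) set" where
  "chart_ran c = coord c ` chart_dom c"

definition param :: "('q, 'n) chart \<Rightarrow> real^'n \<Rightarrow> 'q" where
  "param c = inv_into (chart_dom c) (coord c)"

definition smooth_atlas ::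
  "('q::{t2_space, second_countable_topology}, 'n::finite) chart set \<Rightarrow> bool" where
  "smooth_atlas \<A> \<longleftrightarrow>
     (\<Union>c\<in>\<A>. chart_dom c) = UNIV \<and>
     (\<forall>c\<in>\<A>. open (chart_dom c) \<and> open (chart_ran c) \<and>
        homeomorphism (chart_dom c) (chart_ran c) (coord c) (param c)) \<and>
     (\<forall>c\<in>\<A>. \<forall>d\<in>\<A>. smooth_on (coord c ` (chart_dom c \<inter> chart_dom d)) (coord d \<circ> param c))"

definition smooth_fun :: "('q, 'n::finite) chart set \<Rightarrow> ('q \<Rightarrow> real) \<Rightarrow> bool" where
  "smooth_fun \<A> f \<longleftrightarrow> (\<forall>c\<in>\<A>. smooth_on (chart_ran c) (f \<circ> param c))"

text \<open>The entry \<open>(l, k)\<close> is the derivative of the \<open>l\<close>-th coordinate of \<open>d\<close> with respect to the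
  \<open>k\<close>-th coordinate of \<open>c\<close>.\<close>

definition jacobian_cc :: "('q, 'n::finite) chart \<Rightarrow> ('q, 'n) chart \<Rightarrow> real^'n \<Rightarrow> real^'n^'n" where
  "jacobian_cc c d x = matrix (frechet_derivative (coord d \<circ> param c) (at x))"

text \<open>A tensor field is given by its components in every chart, as functions of the coordinates,
  subject to the transformation law. Thus \<open>\<omega> c x $ k\<close> is the value of the 1-form \<open>\<omega>\<close> on the
  coordinate field \<open>\<partial>\<^sub>k\<close> of the chart \<open>c\<close> at the point with coordinates \<open>x\<close>, and the value on
  the vector with components \<open>u\<close> is \<open>\<omega> c x \<bullet> u\<close>.\<close>

type_synonym ('q, 'n) covfield = "('q, 'n) chart \<Rightarrow> real^'n \<Rightarrow> real^'n"
type_synonym ('q, 'n) vecfield = "('q, 'n) chart \<Rightarrow> real^'n \<Rightarrow> real^'n"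
type_synonym ('q, 'n) tensor2 = "('q, 'n) chart \<Rightarrow> real^'n \<Rightarrow> real^'n^'n"

definition smooth_one_form :: "('q, 'n::finite) chart set \<Rightarrow> ('q, 'n) covfield \<Rightarrow> bool" where
  "smooth_one_form \<A> \<omega> \<longleftrightarrow>
     (\<forall>c\<in>\<A>. smooth_on (chart_ran c) (\<omega> c)) \<and>
     (\<forall>c\<in>\<A>. \<forall>d\<in>\<A>. \<forall>p\<in>chart_dom c \<inter> chart_dom d.
        \<omega> c (coord c p) = transpose (jacobian_cc c d (coord c p)) *v \<omega> d (coord d p))"

definition riemannian_metric :: "('q, 'n::finite) chart set \<Rightarrow> ('q, 'n) tensor2 \<Rightarrow> bool" where
  "riemannian_metric \<A> G \<longleftrightarrow>
     (\<forall>c\<in>\<A>. smooth_on (chart_ran c) (G c)) \<and>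
     (\<forall>c\<in>\<A>. \<forall>x\<in>chart_ran c. transpose (G c x) = G c x \<and> (\<forall>u. u \<noteq> 0 \<longrightarrow> 0 < u \<bullet> (G c x *v u))) \<and>
     (\<forall>c\<in>\<A>. \<forall>d\<in>\<A>. \<forall>p\<in>chart_dom c \<inter> chart_dom d.
        G c (coord c p) = transpose (jacobian_cc c d (coord c p)) ** G d (coord d p)
                            ** jacobian_cc c d (coord c p))"

definition wedge :: "real^'n::finite \<Rightarrow> real^'n \<Rightarrow> real^'n \<Rightarrow> real^'n \<Rightarrow> real" where
  "wedge \<alpha> \<beta> u w = (\<alpha> \<bullet> u) * (\<beta> \<bullet> w) - (\<alpha> \<bullet> w) * (\<beta> \<bullet> u)"

text \<open>The exterior derivative of \<open>\<Sum>k. s\<^sub>k dx\<^sup>k\<close> is \<open>\<Sum>j k. (\<partial>\<^sub>j s\<^sub>k) dx\<^sup>j \<and> dx\<^sup>k\<close>; the covector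
  \<open>dx\<^sup>j\<close> has the components \<open>axis j 1\<close>.\<close>

definition ext_deriv :: "(real^'n::finite \<Rightarrow> real^'n) \<Rightarrow> real^'n \<Rightarrow> real^'n \<Rightarrow> real^'n \<Rightarrow> real" where
  "ext_deriv s x u w =
     (\<Sum>j\<in>UNIV. \<Sum>k\<in>UNIV. partial_deriv j (\<lambda>z. s z $ k) x * wedge (axis j 1) (axis k 1) u w)"

definition lower_index :: "('q, 'n::finite) tensor2 \<Rightarrow> ('q, 'n) vecfield \<Rightarrow> ('q, 'n) covfield" where
  "lower_index G v c x = (\<chi> j. \<Sum>k\<in>UNIV. G c x $ k $ j * v c x $ k)"

definition metric_sq :: "('q, 'n::finite) tensor2 \<Rightarrow> ('q, 'n) chart \<Rightarrow> real^'n \<Rightarrow> real^'n \<Rightarrow> real" where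
  "metric_sq G c x y = (\<Sum>j\<in>UNIV. \<Sum>k\<in>UNIV. G c x $ j $ k * y $ j * y $ k)"

definition kinetic_energy ::
  "('q, 'n::finite) tensor2 \<Rightarrow> ('q, 'n) chart \<Rightarrow> real^'n \<Rightarrow> real^'n \<Rightarrow> real" where
  "kinetic_energy G c x y = 1/2 * metric_sq G c x y"


section \<open>The determinantal vector field\<close>

definition frame_matrix :: "('n \<Rightarrow> ('q, 'n::finite) covfield) \<Rightarrow> ('q, 'n) tensor2" where
  "frame_matrix \<Omega> c x = (\<chi> j k. \<Omega> j c x $ k)"

definition Upsilon :: "('n \<Rightarrow> ('q, 'n::finite) covfield) \<Rightarrow> ('q, 'n) chart \<Rightarrow> real^'n \<Rightarrow> real" where
  "Upsilon \<Omega> c x = det (frame_matrix \<Omega> c x)"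

text \<open>The number \<open>num j\<close> is the position of the index \<open>j\<close> in the list \<open>1, \<dots>, N\<close>, so that
  \<open>num j \<le> M\<close> singles out the given forms.\<close>

definition lambda_tilde ::
  "('n \<Rightarrow> nat) \<Rightarrow> nat \<Rightarrow> ('n \<Rightarrow> 'q \<Rightarrow> real) \<Rightarrow> 'q \<Rightarrow> real^'n::finite" where
  "lambda_tilde num M lam p = (\<chi> j. if num j \<le> M then 0 else lam j p)"

text \<open>The cofactor of the entry \<open>(r, k)\<close>, i.e. the minor with its sign, written as the determinant
  with row \<open>r\<close> replaced by the \<open>k\<close>-th unit row. The formal determinant is the expansion along
  row \<open>r\<close> in which the entries \<open>w k\<close> of that row are vectors; row \<open>r\<close> of \<open>B\<close> itself is not used.\<close>

definition cofactor :: "real^'m^'m::finite \<Rightarrow> 'm \<Rightarrow> 'm \<Rightarrow> real" where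
  "cofactor B r k = det (\<chi> i j. if i = r then (if j = k then 1 else 0) else B $ i $ j)"

definition formal_det ::
  "real^'m^'m::finite \<Rightarrow> 'm \<Rightarrow> ('m \<Rightarrow> 'v::real_vector) \<Rightarrow> 'v" where
  "formal_det B r w = (\<Sum>k\<in>UNIV. cofactor B r k *\<^sub>R w k)"

text \<open>Rows and columns are indexed by \<open>'n option\<close>, where \<open>None\<close> is the last row and column.
  Numbering rows and columns in the same way makes the determinant independent of the numbering.
  The field \<open>\<partial>\<^sub>k\<close> has the components \<open>axis k 1\<close>.\<close>

definition bordered_matrix ::
  "real^'n^'n \<Rightarrow> real^'n \<Rightarrow> real^('n::finite option)^('n option)" where
  "bordered_matrix F l = (\<chi> i j.
     case i of
       Some a \<Rightarrow> (case j of Some k \<Rightarrow> F $ a $ k | None \<Rightarrow> l $ a)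
     | None \<Rightarrow> 0)"

definition det_vector_field ::
  "('n \<Rightarrow> nat) \<Rightarrow> nat \<Rightarrow> ('n \<Rightarrow> ('q, 'n::finite) covfield) \<Rightarrow> ('n \<Rightarrow> 'q \<Rightarrow> real)
     \<Rightarrow> ('q, 'n) vecfield" where
  "det_vector_field num M \<Omega> lam c x =
     (1 / Upsilon \<Omega> c x) *\<^sub>R
       formal_det (bordered_matrix (frame_matrix \<Omega> c x) (lambda_tilde num M lam (param c x))) None
         (\<lambda>j. case j of Some k \<Rightarrow> axis k 1 | None \<Rightarrow> 0)"


section \<open>First and second order systems\<close>

text \<open>Solutions are curves on an open interval; the systems are imposed in every chart of the atlas
  at the times at which the curve is in its domain. Continuity guarantees that the curve then stays
  in the domain for nearby times.\<close>

definition first_order_solution ::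
  "('q::topological_space, 'n::finite) chart set \<Rightarrow> ('q, 'n) vecfield \<Rightarrow> real set \<Rightarrow> (real \<Rightarrow> 'q) \<Rightarrow> bool"
  where
  "first_order_solution \<A> v I \<gamma> \<longleftrightarrow>
     open I \<and> is_interval I \<and> continuous_on I \<gamma> \<and>
     (\<forall>c\<in>\<A>. \<forall>t\<in>I. \<gamma> t \<in> chart_dom c \<longrightarrow>
        ((coord c \<circ> \<gamma>) has_vector_derivative v c (coord c (\<gamma> t))) (at t))"

text \<open>The Lagrange equations with the Lagrange function \<open>T c x y\<close> (\<open>y\<close> is the velocity) and the
  generalized force \<open>F c x\<close>. Asking for the second derivative of the coordinate curve \<open>x\<close> makes
  the use of \<open>deriv\<close> meaningful for a differentiable \<open>\<partial>T/\<partial>y\<close>.\<close>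

definition lagrange_solution ::
  "('q::topological_space, 'n::finite) chart set \<Rightarrow> (('q, 'n) chart \<Rightarrow> real^'n \<Rightarrow> real^'n \<Rightarrow> real)
     \<Rightarrow> ('q, 'n) covfield \<Rightarrow> real set \<Rightarrow> (real \<Rightarrow> 'q) \<Rightarrow> bool" where
  "lagrange_solution \<A> T F I \<gamma> \<longleftrightarrow>
     open I \<and> is_interval I \<and> continuous_on I \<gamma> \<and>
     (\<forall>c\<in>\<A>. \<forall>t\<in>I. \<gamma> t \<in> chart_dom c \<longrightarrow>
        (let x = coord c \<circ> \<gamma>; xdot = (\<lambda>s. vector_derivative x (at s)) in
           x differentiable (at t) \<and> xdot differentiable (at t) \<and>
           (\<forall>k. deriv (\<lambda>s. partial_deriv k (\<lambda>y. T c (x s) y) (xdot s)) t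
                  - partial_deriv k (\<lambda>z. T c z (xdot t)) (x t)
                = F c (x t) $ k)))"

definition invariant_relation ::
  "('q::topological_space, 'n::finite) chart set \<Rightarrow> ('q, 'n) vecfield
     \<Rightarrow> (('q, 'n) chart \<Rightarrow> real^'n \<Rightarrow> real^'n \<Rightarrow> real) \<Rightarrow> ('q, 'n) covfield \<Rightarrow> bool" where
  "invariant_relation \<A> v T F \<longleftrightarrow>
     (\<forall>I \<gamma>. first_order_solution \<A> v I \<gamma> \<longrightarrow> lagrange_solution \<A> T F I \<gamma>)"

end

theory Submission
  imports Defs
begin

text \<open>
  Fix a chart and write \<open>F\<close> for the frame matrix \<open>(\<Omega>\<^sub>j(\<partial>\<^sub>k))\<close> and \<open>l\<close> for the vector
  \<open>(0, \<dots>, 0, \<lambda>\<^sub>M\<^sub>+\<^sub>1, \<dots>, \<lambda>\<^sub>N)\<close>. Two independent facts carry the theorem.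

  The first is linear algebra. Pairing the determinant that defines \<open>v\<close> with \<open>\<Omega>\<^sub>i\<close> replaces its last
  row by \<open>(\<Omega>\<^sub>i(\<partial>\<^sub>1), \<dots>, \<Omega>\<^sub>i(\<partial>\<^sub>N), 0)\<close>, which differs from row \<open>i\<close> only in the last entry, so that
  \<open>F v = - l\<close> (\<open>frame_det_vector_field\<close>). The sign is negative. It is absorbed by the skew symmetry of
  \<open>A\<close>: in the frame, \<open>d\<sigma>(u, w) = (F u) \<bullet> A (F w)\<close>, hence
  \<open>d\<sigma>(v, w) = - l \<bullet> A (F w) = (A l) \<bullet> F w\<close>, and as \<open>F\<close> is invertible the coefficients of the
  contraction are \<open>\<Lambda> = A l\<close> (\<open>frame_coefficients\<close>). The other two formulas are the same identities
  read on the coordinate fields.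

  The second is the identity
  \<open>v(\<sigma>\<^sub>k) - (\<partial>\<^sub>k T)(x, v) = \<partial>\<^sub>k (|v|\<^sup>2 / 2) + d\<sigma>(v, \<partial>\<^sub>k)\<close>
  (\<open>lagrange_identity\<close>), valid for every differentiable field \<open>v\<close>: both sides contain
  \<open>v(\<sigma>\<^sub>k)\<close>, and the rest is the product rule for \<open>\<partial>\<^sub>k\<close> applied to \<open>\<sigma>\<^sub>j = \<Sum>i. G\<^sub>i\<^sub>j v\<^sup>i\<close> and to
  \<open>|v|\<^sup>2\<close>. On a solution of \<open>x' = v(x)\<close> the momentum \<open>\<partial>T/\<partial>y\<^sup>k\<close> at the velocity equals \<open>\<sigma>\<^sub>k\<close> along the
  curve, so the left side is the Lagrange expression. If \<open>\<Lambda>\<^sub>j = 0\<close> for \<open>j > M\<close>, then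
  \<open>\<iota>\<^sub>v d\<sigma> = \<Sum>j\<le>M. \<Lambda>\<^sub>j \<Omega>\<^sub>j\<close>, and the right side is the prescribed force.
\<close>

section \<open>The determinantal vector field in the frame of forms\<close>

text \<open>Among the permutations of the bordered index set only those fixing \<open>None\<close> contribute to \<open>det C\<close>,
because row \<open>None\<close> is a unit row. They correspond, with the same sign, to the permutations of the
inner index set, and none of them meets column \<open>None\<close> outside the corner.\<close>

lemma det_unit_border:
  fixes F :: "real^'n^'n::finite" and C :: "real^('n option)^('n option)"
  assumes block: "\<And>i k. C $ Some i $ Some k = F $ i $ k"
    and unit: "\<And>k. C $ None $ k = (if k = None then 1 else 0)"
  shows "det C = det F"
proof -
  let ?E = "map_permutation UNIV (Some :: 'n \<Rightarrow> 'n option)"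
  let ?t = "\<lambda>p. of_int (sign p) * (\<Prod>i\<in>UNIV. C $ i $ p i)"
  have bij: "bij_betw (Some :: 'n \<Rightarrow> 'n option) UNIV (range Some)"
    by (simp add: bij_betw_def)
  have app: "?E q (Some i) = Some (q i)" for q i
    by (rule map_permutation_apply) auto
  have perm: "?E q permutes range Some" if "q permutes UNIV" for q
    using map_permutation_permutes[OF bij that] .
  have fixNone: "?E q None = None" if "q permutes UNIV" for q
    using permutes_not_in[OF perm[OF that], of None] by auto
  have img: "?E ` {q. q permutes UNIV} = {p. p permutes range Some}"
  proof (intro equalityI subsetI)
    fix p :: "'n option \<Rightarrow> 'n option" assume "p \<in> {p. p permutes range Some}"
    then have p: "p permutes range Some" by simp
    let ?q = "map_permutation (range Some) the p"
    have b': "bij_betw the (range (Some :: 'n \<Rightarrow> 'n option)) UNIV"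
      by (auto simp: bij_betw_def inj_on_def image_image)
    have q: "?q permutes UNIV" using map_permutation_permutes[OF b' p] .
    have "?E ?q = p"
      by (rule map_permutation_compose_inv[OF b' p]) auto
    then show "p \<in> ?E ` {q. q permutes UNIV}" using q by (metis imageI mem_Collect_eq)
  qed (use perm in auto)
  have inj: "inj_on ?E {q. q permutes UNIV}"
    by (rule inj_onI) (metis app option.inject ext)
  \<comment> \<open>A permutation that moves \<open>None\<close> picks a zero entry of the unit row.\<close>
  have term0: "?t p = 0" if "p permutes UNIV" "\<not> p permutes range Some" for p
  proof -
    have "p None \<noteq> None"
    proof
      assume "p None = None"
      then have "\<And>i. i \<notin> range Some \<Longrightarrow> p i = i" by (metis not_None_eq rangeI)
      with that show False
        using permutes_superset[OF that(1), of "range Some"] by auto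
    qed
    then have "(\<Prod>i\<in>UNIV. C $ i $ p i) = 0"
      by (intro prod_zero) (use unit in \<open>auto intro!: exI[of _ None]\<close>)
    then show ?thesis by simp
  qed
  have termE: "?t (?E q) = of_int (sign q) * (\<Prod>i\<in>UNIV. F $ i $ q i)" if "q permutes UNIV" for q
  proof -
    have "(\<Prod>i\<in>UNIV. C $ i $ ?E q i) = (\<Prod>i\<in>insert None (range Some). C $ i $ ?E q i)"
      by (simp add: UNIV_option_conv)
    also have "\<dots> = (\<Prod>i\<in>range Some. C $ i $ ?E q i)"
      by (subst prod.insert) (auto simp: unit fixNone[OF that])
    also have "\<dots> = (\<Prod>i\<in>UNIV. F $ i $ q i)"
      by (subst prod.reindex) (auto simp: app block)
    finally show ?thesis
      using sign_map_permutation[of Some UNIV q] that by simp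
  qed
  have "det C = (\<Sum>p | p permutes range Some. ?t p)"
    unfolding det_def
  proof (rule sum.mono_neutral_right)
    show "{p :: 'n option \<Rightarrow> 'n option. p permutes range Some} \<subseteq> {p. p permutes UNIV}"
      by (auto intro: permutes_subset)
  qed (use term0 in \<open>auto simp: finite_permutations\<close>)
  also have "\<dots> = (\<Sum>q | q permutes UNIV. ?t (?E q))"
    unfolding img[symmetric] using sum.reindex[OF inj, of ?t] by simp
  also have "\<dots> = det F"
    unfolding det_def by (rule sum.cong) (use termE in auto)
  finally show ?thesis .
qed

text \<open>Laplace expansion along row \<open>r\<close>: each cofactor is a determinant with a unit row, and the
determinant is linear in that row.\<close>

lemma cofactor_sum:
  "(\<Sum>k\<in>UNIV. a k * cofactor B r k) = det (\<chi> i. if i = r then (\<chi> k. a k) else B $ i)"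
proof -
  have "cofactor B r k = det (\<chi> i. if i = r then axis k 1 else B $ i)" for k
    unfolding cofactor_def
    by (rule arg_cong[where f=det]) (auto simp: vec_eq_iff axis_def)
  then have "(\<Sum>k\<in>UNIV. a k * cofactor B r k) =
      (\<Sum>k\<in>UNIV. det (\<chi> i. if i = r then a k *s axis k 1 else B $ i))"
    by (simp add: det_row_mul)
  also have "\<dots> = det (\<chi> i. if i = r then (\<Sum>k\<in>UNIV. a k *s axis k 1) else B $ i)"
    by (simp add: det_linear_row_sum)
  also have "(\<Sum>k\<in>UNIV. a k *s axis k 1) = (\<chi> k. a k)"
    by (simp add: vec_eq_iff axis_def if_distrib cong: if_cong)
  finally show ?thesis .
qed

text \<open>Row \<open>i\<close> of the bordered matrix, put in place of the last row, gives a determinant with two equal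
rows. Its expansion along the last row is row \<open>i\<close> of \<open>F\<close> paired with the formal determinant, plus \<open>l $ i\<close>
times the corner cofactor \<open>det F\<close>.\<close>

lemma frame_formal_det:
  fixes F :: "real^'n^'n::finite" and l :: "real^'n"
  shows "F *v formal_det (bordered_matrix F l) None (\<lambda>j. case j of Some k \<Rightarrow> axis k 1 | None \<Rightarrow> 0)
         = - (det F *s l)"
proof -
  let ?B = "bordered_matrix F l"
  have comp: "formal_det ?B None (\<lambda>j. case j of Some k \<Rightarrow> axis k 1 | None \<Rightarrow> 0) $ k
      = cofactor ?B None (Some k)" for k
    by (simp add: formal_det_def UNIV_option_conv sum.reindex axis_def if_distrib cong: if_cong)
  have last: "cofactor ?B None None = det F"
    unfolding cofactor_def
    by (rule det_unit_border) (auto simp: bordered_matrix_def)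
  have "(\<Sum>k\<in>UNIV. F $ i $ k * cofactor ?B None (Some k)) + l $ i * det F = 0" for i
  proof -
    have "(\<Sum>j\<in>UNIV. ?B $ Some i $ j * cofactor ?B None j) = 0"
      unfolding cofactor_sum
      by (rule det_identical_rows[of None "Some i"]) (auto simp: row_def)
    then show ?thesis
      by (simp add: UNIV_option_conv sum.reindex last add.commute) (simp add: bordered_matrix_def)
  qed
  then show ?thesis
    by (simp add: vec_eq_iff matrix_vector_mult_def comp eq_neg_iff_add_eq_0 mult.commute)
qed

lemma frame_det_vector_field:
  assumes "Upsilon \<Omega> c x \<noteq> 0"
  shows "frame_matrix \<Omega> c x *v det_vector_field num M \<Omega> lam c x
         = - lambda_tilde num M lam (param c x)"
  unfolding det_vector_field_def matrix_vector_mult_scaleR frame_formal_det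
  using assms by (simp add: Upsilon_def scalar_mult_eq_scaleR)

section \<open>Two-forms expanded in a frame\<close>

text \<open>The two halves of the wedge product contribute equally because \<open>A\<close> is skew, which cancels the
factor \<open>1/2\<close>.\<close>

lemma skew_wedge_sum:
  fixes A :: "real^'n^'n::finite"
  assumes "transpose A = - A"
  shows "1/2 * (\<Sum>j\<in>UNIV. \<Sum>k\<in>UNIV. A $ j $ k * wedge (F $ j) (F $ k) u w)
         = (F *v u) \<bullet> (A *v (F *v w))"
proof -
  let ?b = "\<lambda>u w. \<Sum>j\<in>UNIV. \<Sum>k\<in>UNIV. A $ j $ k * (F $ j \<bullet> u) * (F $ k \<bullet> w)"
  have skew: "A $ k $ j = - A $ j $ k" for j k
    using arg_cong[OF assms, of "\<lambda>B. B $ j $ k"] by (simp add: transpose_def)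
  have flip: "A $ j $ k * p * q = - (A $ k $ j * q * p)" for j k p q
    by (simp add: skew[of k j])
  have "?b w u = (\<Sum>k\<in>UNIV. \<Sum>j\<in>UNIV. A $ j $ k * (F $ j \<bullet> w) * (F $ k \<bullet> u))"
    by (rule sum.swap)
  also have "\<dots> = (\<Sum>k\<in>UNIV. \<Sum>j\<in>UNIV. - (A $ k $ j * (F $ k \<bullet> u) * (F $ j \<bullet> w)))"
    by (intro sum.cong refl) (rule flip)
  finally have "?b w u = - ?b u w"
    by (simp add: sum_negf)
  moreover have "(\<Sum>j\<in>UNIV. \<Sum>k\<in>UNIV. A $ j $ k * wedge (F $ j) (F $ k) u w) = ?b u w - ?b w u"
    unfolding wedge_def sum_subtractf[symmetric]
    by (intro sum.cong refl) (simp add: algebra_simps)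
  moreover have "(F *v u) \<bullet> (A *v (F *v w)) = ?b u w"
  proof -
    have "(A *v y) $ j = (\<Sum>k\<in>UNIV. A $ j $ k * y $ k)" for y j
      by (simp add: matrix_vector_mult_def)
    then show ?thesis
      by (simp add: inner_vec_def[of "F *v u"] matrix_vector_mul_component[of F]
          sum_distrib_left mult_ac)
  qed
  ultimately show ?thesis by simp
qed

text \<open>The vectors \<open>F w\<close> exhaust the space, so a pairing with all of them determines \<open>L\<close>. Moving \<open>A\<close> to
the other factor changes its sign, which compensates the sign in \<open>F v = - l\<close>.\<close>

lemma frame_coefficients:
  fixes A F :: "real^'n^'n::finite"
  assumes skew: "transpose A = - A" and inv: "invertible F" and Fv: "F *v v = - l"
    and L: "\<And>w. (F *v v) \<bullet> (A *v (F *v w)) = L \<bullet> (F *v w)"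
  shows "L = A *v l"
proof -
  have "L \<bullet> y = (A *v l) \<bullet> y" for y
  proof -
    obtain w where w: "F *v w = y"
      using inv by (metis invertible_def matrix_vector_mul_assoc matrix_vector_mul_lid)
    have "L \<bullet> y = - (l \<bullet> (A *v y))"
      using L[of w] by (simp add: Fv w)
    also have "l \<bullet> (A *v y) = (transpose A *v l) \<bullet> y"
      by (metis dot_lmul_matrix transpose_matrix_vector)
    finally show ?thesis by (simp add: skew matrix_vector_mult_def inner_vec_def sum_negf)
  qed
  then show ?thesis by (metis vector_eq_ldot inner_commute)
qed

section \<open>Differentiability\<close>

lemma smooth_on_imp_differentiable:
  assumes "smooth_on S f" "open S" "x \<in> S"
  shows "f differentiable (at x)"
proof -
  have "Ck_on (Suc 0) S f" using assms(1) unfolding smooth_on_def by blast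
  then show ?thesis using assms by (simp add: differentiable_on_eq_differentiable_at)
qed

lemma differentiable_vec_nth:
  assumes "f differentiable F"
  shows "(\<lambda>z. f z $ i) differentiable F"
  using assms bounded_linear.has_derivative[OF bounded_linear_vec_nth]
  unfolding differentiable_def by blast

lemma differentiable_vecI:
  fixes f :: "'a::real_normed_vector \<Rightarrow> real^'n::finite"
  assumes "\<And>i. (\<lambda>z. f z $ i) differentiable (at x)"
  shows "f differentiable (at x)"
proof -
  obtain D where D: "\<And>i. ((\<lambda>z. f z $ i) has_derivative D i) (at x)"
    using assms unfolding differentiable_def by metis
  have "(f has_derivative (\<lambda>h. \<chi> i. D i h)) (at x)"
    using D by (subst has_derivative_componentwise_within)
      (auto simp: Basis_vec_def inner_axis)
  then show ?thesis unfolding differentiable_def by blast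
qed

lemma differentiable_det:
  fixes f :: "'a::real_normed_vector \<Rightarrow> real^'n^'n::finite"
  assumes "\<And>i j. (\<lambda>z. f z $ i $ j) differentiable (at x)"
  shows "(\<lambda>z. det (f z)) differentiable (at x)"
proof -
  have "(\<lambda>z. \<Prod>i\<in>UNIV. f z $ i $ p i) differentiable (at x)" for p
  proof -
    have "\<forall>i. \<exists>D. ((\<lambda>z. f z $ i $ p i) has_derivative D) (at x)"
      using assms unfolding differentiable_def by blast
    then obtain D where "\<forall>i. ((\<lambda>z. f z $ i $ p i) has_derivative D i) (at x)"
      by (rule exE[OF choice])
    then have "((\<lambda>z. \<Prod>i\<in>UNIV. f z $ i $ p i) has_derivative
        (\<lambda>y. \<Sum>i\<in>UNIV. D i y * (\<Prod>j\<in>UNIV - {i}. f x $ j $ p j))) (at x)"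
      by (intro has_derivative_prod) blast
    then show ?thesis unfolding differentiable_def by blast
  qed
  then show ?thesis unfolding det_def
    by (intro differentiable_sum differentiable_mult) (auto simp: finite_permutations)
qed

text \<open>In a chart the components of the field are rational functions of the coefficients of the forms and
of the functions \<open>\<lambda>\<^sub>j\<close>, with the denominator \<open>\<Upsilon>\<close>. This makes the velocity of an integral curve
differentiable, so that the second order system is meaningful on it.\<close>

lemma det_vector_field_differentiable:
  fixes \<A> :: "('q::{t2_space, second_countable_topology}, 'n::finite) chart set"
    and \<Omega> :: "'n \<Rightarrow> ('q, 'n) covfield"
  assumes atlas: "smooth_atlas \<A>" and c: "c \<in> \<A>" and x: "x \<in> chart_ran c"
    and forms: "\<And>j. smooth_one_form \<A> (\<Omega> j)"
    and nz: "Upsilon \<Omega> c x \<noteq> 0"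
    and lam: "\<And>j. M < num j \<Longrightarrow> smooth_fun \<A> (lam j)"
  shows "det_vector_field num M \<Omega> lam c differentiable (at x)"
proof -
  have op: "open (chart_ran c)" using atlas c unfolding smooth_atlas_def by blast
  have dF: "(\<lambda>z. frame_matrix \<Omega> c z $ a $ k) differentiable (at x)" for a k
    using smooth_on_imp_differentiable[OF _ op x, of "\<Omega> a c"] forms[of a] c
    by (auto simp: frame_matrix_def smooth_one_form_def intro: differentiable_vec_nth)
  have dl: "(\<lambda>z. lambda_tilde num M lam (param c z) $ a) differentiable (at x)" for a
    using smooth_on_imp_differentiable[OF _ op x, of "lam a \<circ> param c"] lam[of a] c
    by (cases "num a \<le> M") (auto simp: lambda_tilde_def smooth_fun_def o_def)
  have dB: "(\<lambda>z. bordered_matrix (frame_matrix \<Omega> c z) (lambda_tilde num M lam (param c z)) $ i $ j)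
      differentiable (at x)" for i j
    by (cases i; cases j) (simp_all add: bordered_matrix_def dF dl)
  have dcof: "(\<lambda>z. cofactor (bordered_matrix (frame_matrix \<Omega> c z)
      (lambda_tilde num M lam (param c z))) r k) differentiable (at x)" for r k
    unfolding cofactor_def
  proof (rule differentiable_det)
    fix i j
    show "(\<lambda>z. (\<chi> i j. if i = r then if j = k then 1 else 0
        else bordered_matrix (frame_matrix \<Omega> c z) (lambda_tilde num M lam (param c z)) $ i $ j) $ i $ j)
        differentiable (at x)"
      by (cases "i = r"; cases "j = k") (simp_all add: dB)
  qed
  have dU: "(\<lambda>z. Upsilon \<Omega> c z) differentiable (at x)"
    unfolding Upsilon_def by (rule differentiable_det) (rule dF)
  have "(\<lambda>z. 1 / Upsilon \<Omega> c z) differentiable (at x)"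
    using dU nz by simp
  moreover have "(\<lambda>z. \<Sum>k\<in>UNIV. cofactor (bordered_matrix (frame_matrix \<Omega> c z)
      (lambda_tilde num M lam (param c z))) None k *\<^sub>R
      ((case k of Some k \<Rightarrow> axis k 1 | None \<Rightarrow> 0) :: real^'n)) differentiable (at x)"
    by (intro differentiable_sum ballI finite differentiable_scaleR[OF dcof] differentiable_const)
  ultimately show ?thesis
    unfolding det_vector_field_def[abs_def] formal_det_def
    by (rule differentiable_scaleR)
qed

section \<open>The Lagrange expression along an integral curve\<close>

lemma partial_deriv_eq:
  "(f has_derivative D) (at x) \<Longrightarrow> partial_deriv k f x = D (axis k 1)"
  unfolding partial_deriv_def by (metis frechet_derivative_at)

lemma partial_deriv_sum:
  assumes "\<And>i. i \<in> I \<Longrightarrow> f i differentiable (at x)"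
  shows "partial_deriv k (\<lambda>z. \<Sum>i\<in>I. f i z) x = (\<Sum>i\<in>I. partial_deriv k (f i) x)"
proof -
  have "((\<lambda>z. \<Sum>i\<in>I. f i z) has_derivative (\<lambda>h. \<Sum>i\<in>I. frechet_derivative (f i) (at x) h)) (at x)"
    using assms by (intro has_derivative_sum) (simp add: frechet_derivative_works)
  from partial_deriv_eq[OF this] show ?thesis by (simp add: partial_deriv_def)
qed

lemma partial_deriv_mult:
  assumes "f differentiable (at x)" "g differentiable (at x)"
  shows "partial_deriv k (\<lambda>z. f z * g z) x = partial_deriv k f x * g x + f x * partial_deriv k g x"
  using partial_deriv_eq[OF has_derivative_mult[OF assms[unfolded frechet_derivative_works]], of k]
  by (simp add: partial_deriv_def)

lemma partial_deriv_const: "partial_deriv k (\<lambda>z. a) x = 0"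
  by (simp add: partial_deriv_def)

lemma partial_deriv_cmult:
  assumes "f differentiable (at x)"
  shows "partial_deriv k (\<lambda>z. a * f z) x = a * partial_deriv k f x"
  by (simp add: partial_deriv_mult partial_deriv_const assms)

lemma partial_deriv_coordinate: "partial_deriv k (\<lambda>y. y $ i) y = (if i = k then 1 else 0)"
  by (subst partial_deriv_eq[OF bounded_linear.has_derivative[OF bounded_linear_vec_nth has_derivative_ident]])
    (simp add: axis_def)

text \<open>A condition on the outer index of a double sum is moved out of the inner sum, where the rules for
sums with a single nonzero term can evaluate it.\<close>

lemma sum_if_const:
  "(\<Sum>j\<in>J. if P then f j else 0) = (if P then \<Sum>j\<in>J. f j else 0)"
  by simp

text \<open>The momentum that belongs to the velocity \<open>y\<close>: for \<open>y = v(x)\<close> the right-hand side is the component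
\<open>\<sigma>\<^sub>k\<close> of the associated 1-form.\<close>

lemma momentum_kinetic_energy:
  fixes G :: "('q, 'n::finite) tensor2"
  assumes "transpose (G c x) = G c x"
  shows "partial_deriv k (\<lambda>y. kinetic_energy G c x y) y = (\<Sum>j\<in>UNIV. G c x $ j $ k * y $ j)"
proof -
  have sym: "G c x $ k $ j = G c x $ j $ k" for j k
    using arg_cong[OF assms, of "\<lambda>B. B $ j $ k"] by (simp add: transpose_def)
  have d: "(\<lambda>y::real^'n. y $ i) differentiable (at y)" for i
    by (rule differentiable_vec_nth) simp
  have "partial_deriv k (\<lambda>y. kinetic_energy G c x y) y =
    1/2 * (\<Sum>i\<in>UNIV. \<Sum>j\<in>UNIV. G c x $ i $ j * ((if i = k then 1 else 0) * y $ j + y $ i * (if j = k then 1 else 0)))"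
    unfolding kinetic_energy_def metric_sq_def
    by (subst partial_deriv_cmult)
      (simp_all add: partial_deriv_sum partial_deriv_mult partial_deriv_const
        partial_deriv_coordinate d algebra_simps)
  also have "\<dots> = 1/2 * (\<Sum>i\<in>UNIV. \<Sum>j\<in>UNIV.
      (if i = k then G c x $ i $ j * y $ j else 0) + (if j = k then G c x $ i $ j * y $ i else 0))"
    by (intro arg_cong[where f = "(*) (1/2)"] sum.cong refl) auto
  also have "\<dots> = 1/2 * ((\<Sum>j\<in>UNIV. G c x $ k $ j * y $ j) + (\<Sum>i\<in>UNIV. G c x $ i $ k * y $ i))"
    by (simp add: sum.distrib sum_if_const)
  also have "(\<Sum>j\<in>UNIV. G c x $ k $ j * y $ j) = (\<Sum>j\<in>UNIV. G c x $ j $ k * y $ j)"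
    by (intro sum.cong refl) (simp add: sym[of k])
  finally show ?thesis by simp
qed

lemma ext_deriv_axis:
  "ext_deriv s x u (axis k 1) =
     (\<Sum>j\<in>UNIV. u $ j * (partial_deriv j (\<lambda>z. s z $ k) x - partial_deriv k (\<lambda>z. s z $ j) x))"
proof -
  have w: "wedge (axis i 1) (axis j 1) u (axis k 1)
      = (if j = k then u $ i else 0) - (if i = k then u $ j else 0)" for i j :: 'a
  proof -
    have "(axis a 1 :: real^'a) $ b = (if b = a then 1 else 0)" for a b
      by (simp add: axis_def)
    then show ?thesis by (simp add: wedge_def inner_axis inner_axis')
  qed
  show ?thesis
    unfolding ext_deriv_def w
    by (simp add: right_diff_distrib sum_subtractf if_distrib[of "\<lambda>y. _ * y"] sum_if_const
        mult.commute cong: if_cong)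
qed

text \<open>Cartan's formula \<open>L\<^sub>v \<sigma> = \<iota>\<^sub>v d\<sigma> + d(\<iota>\<^sub>v \<sigma>)\<close> in components, with \<open>\<iota>\<^sub>v \<sigma> = |v|\<^sup>2\<close>. The contraction is
\<open>v(\<sigma>\<^sub>k) - \<Sum>j. (\<partial>\<^sub>k \<sigma>\<^sub>j) v\<^sup>j\<close>. The subtracted sum is \<open>\<partial>\<^sub>k T\<close> at the fixed velocity, taken twice, plus a
term with \<open>\<partial>\<^sub>k v\<close>, whereas \<open>\<partial>\<^sub>k (|v|\<^sup>2 / 2)\<close> contains \<open>\<partial>\<^sub>k T\<close> once and the same term with \<open>\<partial>\<^sub>k v\<close>.\<close>

lemma lagrange_identity:
  fixes G :: "('q, 'n::finite) tensor2" and v :: "('q, 'n) vecfield"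
  assumes dG: "G c differentiable (at x)" and dv: "v c differentiable (at x)"
    and symm: "transpose (G c x) = G c x"
  shows "(\<Sum>j\<in>UNIV. partial_deriv j (\<lambda>z. lower_index G v c z $ k) x * v c x $ j)
           - partial_deriv k (\<lambda>z. kinetic_energy G c z (v c x)) x
         = partial_deriv k (\<lambda>z. 1/2 * metric_sq G c z (v c z)) x
           + ext_deriv (lower_index G v c) x (v c x) (axis k 1)"
proof -
  let ?V = "v c x"
  let ?g = "\<lambda>i j. partial_deriv k (\<lambda>z. G c z $ i $ j) x"
  let ?w = "\<lambda>i. partial_deriv k (\<lambda>z. v c z $ i) x"
  have sym: "G c x $ i $ j = G c x $ j $ i" for i j
    using arg_cong[OF symm, of "\<lambda>B. B $ j $ i"] by (simp add: transpose_def)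
  have d: "(\<lambda>z. G c z $ i $ j) differentiable (at x)" "(\<lambda>z. v c z $ i) differentiable (at x)" for i j
    by (intro differentiable_vec_nth dG dv)+
  have flip: "G c x $ i $ j * p * q = G c x $ j $ i * q * p" for i j p q
    by (simp add: sym[of i j])
  have a: "partial_deriv k (\<lambda>z. kinetic_energy G c z (v c x)) x
      = 1/2 * (\<Sum>i\<in>UNIV. \<Sum>j\<in>UNIV. ?g i j * ?V $ i * ?V $ j)"
    unfolding kinetic_energy_def metric_sq_def
    by (subst partial_deriv_cmult)
      (simp_all add: partial_deriv_sum partial_deriv_mult partial_deriv_const d)
  have b: "partial_deriv k (\<lambda>z. 1/2 * metric_sq G c z (v c z)) x
      = 1/2 * (\<Sum>i\<in>UNIV. \<Sum>j\<in>UNIV. ?g i j * ?V $ i * ?V $ j)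
        + (\<Sum>i\<in>UNIV. \<Sum>j\<in>UNIV. G c x $ i $ j * ?w i * ?V $ j)"
  proof -
    have "partial_deriv k (\<lambda>z. 1/2 * metric_sq G c z (v c z)) x
      = 1/2 * ((\<Sum>i\<in>UNIV. \<Sum>j\<in>UNIV. ?g i j * ?V $ i * ?V $ j)
        + (\<Sum>i\<in>UNIV. \<Sum>j\<in>UNIV. G c x $ i $ j * ?w i * ?V $ j)
        + (\<Sum>i\<in>UNIV. \<Sum>j\<in>UNIV. G c x $ i $ j * ?V $ i * ?w j))"
      unfolding metric_sq_def
      by (subst partial_deriv_cmult)
        (simp_all add: partial_deriv_sum partial_deriv_mult d distrib_right sum.distrib add_ac)
    also have "(\<Sum>i\<in>UNIV. \<Sum>j\<in>UNIV. G c x $ i $ j * ?V $ i * ?w j)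
        = (\<Sum>i\<in>UNIV. \<Sum>j\<in>UNIV. G c x $ i $ j * ?w i * ?V $ j)"
    proof -
      have "(\<Sum>i\<in>UNIV. \<Sum>j\<in>UNIV. G c x $ i $ j * ?V $ i * ?w j)
          = (\<Sum>j\<in>UNIV. \<Sum>i\<in>UNIV. G c x $ i $ j * ?V $ i * ?w j)"
        by (rule sum.swap)
      also have "\<dots> = (\<Sum>j\<in>UNIV. \<Sum>i\<in>UNIV. G c x $ j $ i * ?w j * ?V $ i)"
        by (intro sum.cong refl) (rule flip)
      finally show ?thesis .
    qed
    finally show ?thesis by simp
  qed
  have e: "(\<Sum>j\<in>UNIV. partial_deriv k (\<lambda>z. lower_index G v c z $ j) x * ?V $ j)
      = (\<Sum>i\<in>UNIV. \<Sum>j\<in>UNIV. ?g i j * ?V $ i * ?V $ j)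
        + (\<Sum>i\<in>UNIV. \<Sum>j\<in>UNIV. G c x $ i $ j * ?w i * ?V $ j)"
  proof -
    have "(\<Sum>j\<in>UNIV. partial_deriv k (\<lambda>z. lower_index G v c z $ j) x * ?V $ j)
        = (\<Sum>j\<in>UNIV. \<Sum>i\<in>UNIV. ?g i j * ?V $ i * ?V $ j + G c x $ i $ j * ?w i * ?V $ j)"
      unfolding lower_index_def
      by (simp add: partial_deriv_sum partial_deriv_mult d distrib_right sum_distrib_right)
    also have "\<dots> = (\<Sum>i\<in>UNIV. \<Sum>j\<in>UNIV. ?g i j * ?V $ i * ?V $ j + G c x $ i $ j * ?w i * ?V $ j)"
      by (rule sum.swap)
    finally show ?thesis by (simp add: sum.distrib)
  qed
  have f: "ext_deriv (lower_index G v c) x ?V (axis k 1)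
     = (\<Sum>j\<in>UNIV. partial_deriv j (\<lambda>z. lower_index G v c z $ k) x * ?V $ j)
       - (\<Sum>j\<in>UNIV. partial_deriv k (\<lambda>z. lower_index G v c z $ j) x * ?V $ j)"
    by (simp add: ext_deriv_axis right_diff_distrib sum_subtractf mult.commute)
  show ?thesis unfolding a b e f by simp
qed

lemma deriv_along_curve:
  assumes f: "f differentiable (at (x t))" and x: "(x has_vector_derivative u) (at t)"
  shows "deriv (\<lambda>s. f (x s)) t = (\<Sum>j\<in>UNIV. partial_deriv j f (x t) * u $ j)"
proof -
  let ?D = "frechet_derivative f (at (x t))"
  have D: "(f has_derivative ?D) (at (x t))" using f by (simp add: frechet_derivative_works)
  have lin: "linear ?D" using D has_derivative_linear by blast
  have "((\<lambda>s. f (x s)) has_vector_derivative ?D u) (at t)"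
    using vector_derivative_diff_chain_within[of x u t UNIV f ?D] x D by (simp add: o_def has_derivative_at_withinI)
  then have "deriv (\<lambda>s. f (x s)) t = ?D u"
    by (intro DERIV_imp_deriv) (simp add: has_real_derivative_iff_has_vector_derivative)
  also have "?D u = ?D (\<Sum>j\<in>UNIV. u $ j *s axis j 1)"
    by (simp add: basis_expansion)
  also have "\<dots> = (\<Sum>j\<in>UNIV. u $ j * ?D (axis j 1))"
    using lin by (simp add: linear_sum scalar_mult_eq_scaleR linear_scale)
  finally show ?thesis by (simp add: partial_deriv_def mult.commute)
qed

section \<open>Integral curves as solutions of the Lagrange equations\<close>

theorem theorem1p1:
  fixes \<A> :: "('q::{t2_space, second_countable_topology}, 'n::finite) chart set"
    and G :: "('q, 'n) tensor2"
    and \<Omega> :: "'n \<Rightarrow> ('q, 'n) covfield"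
    and lam :: "'n \<Rightarrow> 'q \<Rightarrow> real"
    and num :: "'n \<Rightarrow> nat" and M N :: nat
    and v :: "('q, 'n) vecfield" and \<sigma> :: "('q, 'n) covfield"
    and A :: "'q \<Rightarrow> real^'n^'n" and \<Lambda> :: "'q \<Rightarrow> real^'n"
    and H :: "('q, 'n) tensor2" and \<tau> :: "('q, 'n) covfield"
  assumes atlas: "smooth_atlas \<A>"
    and dim: "N = CARD('n)"
    and num: "bij_betw num UNIV {1..N}"
    and M_less: "M < N"
    and metric: "riemannian_metric \<A> G"
    and forms: "\<And>j. smooth_one_form \<A> (\<Omega> j)"
    and Upsilon_nonzero: "\<And>c x. c \<in> \<A> \<Longrightarrow> x \<in> chart_ran c \<Longrightarrow> Upsilon \<Omega> c x \<noteq> 0"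
    and lam_smooth: "\<And>j. M < num j \<Longrightarrow> smooth_fun \<A> (lam j)"
    and v_def: "v = det_vector_field num M \<Omega> lam"
    and \<sigma>_def: "\<sigma> = lower_index G v"
    and A_skew: "\<And>p. transpose (A p) = - A p"
    and A_expansion: "\<And>c x u w. c \<in> \<A> \<Longrightarrow> x \<in> chart_ran c \<Longrightarrow>
          ext_deriv (\<sigma> c) x u w =
            1/2 * (\<Sum>j\<in>UNIV. \<Sum>k\<in>UNIV. A (param c x) $ j $ k * wedge (\<Omega> j c x) (\<Omega> k c x) u w)"
    and \<Lambda>_expansion: "\<And>c x w. c \<in> \<A> \<Longrightarrow> x \<in> chart_ran c \<Longrightarrow>
          ext_deriv (\<sigma> c) x (v c x) w = (\<Sum>j\<in>UNIV. \<Lambda> (param c x) $ j * (\<Omega> j c x \<bullet> w))"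
    and H_def: "H = (\<lambda>c x. \<chi> j k. ext_deriv (\<sigma> c) x (axis j 1) (axis k 1))"
    and \<tau>_def: "\<tau> = (\<lambda>c x. \<chi> k. ext_deriv (\<sigma> c) x (v c x) (axis k 1))"
  shows "(\<forall>c\<in>\<A>. \<forall>x\<in>chart_ran c.
            H c x = transpose (frame_matrix \<Omega> c x) ** A (param c x) ** frame_matrix \<Omega> c x \<and>
            \<Lambda> (param c x) = A (param c x) *v lambda_tilde num M lam (param c x) \<and>
            \<Lambda> (param c x) = matrix_inv (transpose (frame_matrix \<Omega> c x)) *v \<tau> c x) \<and>
         ((\<forall>p j. j \<in> num -` {M+1..N} \<longrightarrow> \<Lambda> p $ j = 0) \<longrightarrow>
            invariant_relation \<A> v (kinetic_energy G)
              (\<lambda>c x. \<chi> k. partial_deriv k (\<lambda>z. 1/2 * metric_sq G c z (v c z)) x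
                           + (\<Sum>j\<in>num -` {1..M}. \<Lambda> (param c x) $ j * \<Omega> j c x $ k)))"
proof (intro conjI[rotated] impI)
  have chart: "open (chart_dom c)" "open (chart_ran c)"
    if "c \<in> \<A>" for c
    using atlas that unfolding smooth_atlas_def by blast+
  have frame: "(F *v u) $ j = \<Omega> j c x \<bullet> u" if "F = frame_matrix \<Omega> c x" for F c x u j
    by (simp add: that frame_matrix_def matrix_vector_mul_component row_def)
  have row: "frame_matrix \<Omega> c x $ j = \<Omega> j c x" for c x j
    by (simp add: frame_matrix_def vec_eq_iff)
  have dsigma: "ext_deriv (\<sigma> c) x u w = (frame_matrix \<Omega> c x *v u) \<bullet>
      (A (param c x) *v (frame_matrix \<Omega> c x *v w))" if "c \<in> \<A>" "x \<in> chart_ran c" for c x u w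
    using skew_wedge_sum[OF A_skew, of "param c x" "frame_matrix \<Omega> c x" u w]
    by (simp add: A_expansion[OF that] row)
  have contraction: "ext_deriv (\<sigma> c) x (v c x) w = \<Lambda> (param c x) \<bullet> (frame_matrix \<Omega> c x *v w)"
    if "c \<in> \<A>" "x \<in> chart_ran c" for c x w
    by (simp add: \<Lambda>_expansion[OF that] inner_vec_def[of "\<Lambda> (param c x)"] frame)
  have Fv: "frame_matrix \<Omega> c x *v v c x = - lambda_tilde num M lam (param c x)"
    if "c \<in> \<A>" "x \<in> chart_ran c" for c x
    unfolding v_def by (rule frame_det_vector_field[OF Upsilon_nonzero[OF that]])
  show "\<forall>c\<in>\<A>. \<forall>x\<in>chart_ran c.
            H c x = transpose (frame_matrix \<Omega> c x) ** A (param c x) ** frame_matrix \<Omega> c x \<and>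
            \<Lambda> (param c x) = A (param c x) *v lambda_tilde num M lam (param c x) \<and>
            \<Lambda> (param c x) = matrix_inv (transpose (frame_matrix \<Omega> c x)) *v \<tau> c x"
  proof (intro ballI conjI)
    fix c x assume cx: "c \<in> \<A>" "x \<in> chart_ran c"
    let ?F = "frame_matrix \<Omega> c x" and ?A = "A (param c x)" and ?L = "\<Lambda> (param c x)"
    have inv: "invertible ?F"
      using Upsilon_nonzero[OF cx] by (simp add: Upsilon_def invertible_det_nz)
    have H: "H c x $ j $ k = axis j 1 \<bullet> ((transpose ?F ** ?A ** ?F) *v axis k 1)" for j k
    proof -
      have "a \<bullet> (transpose ?F *v b) = (?F *v a) \<bullet> b" for a b
        by (metis dot_lmul_matrix inner_commute transpose_matrix_vector)
      then show ?thesis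
        by (simp add: H_def dsigma[OF cx] matrix_vector_mul_assoc[symmetric] del: transpose_matrix_vector)
    qed
    show "H c x = transpose ?F ** ?A ** ?F"
      by (simp add: vec_eq_iff H inner_axis' matrix_vector_mult_basis column_def)
    show "?L = ?A *v lambda_tilde num M lam (param c x)"
      by (rule frame_coefficients[OF A_skew inv Fv[OF cx]])
        (simp add: dsigma[OF cx, symmetric] contraction[OF cx])
    have tau: "\<tau> c x = transpose ?F *v ?L"
      by (simp add: vec_eq_iff \<tau>_def \<Lambda>_expansion[OF cx] inner_axis matrix_vector_mult_def
          transpose_def row mult.commute)
    have "matrix_inv (transpose ?F) ** transpose ?F = mat 1"
      using transpose_invertible[OF inv] unfolding invertible_def matrix_inv_def
      by (rule someI2_ex) simp
    then show "?L = matrix_inv (transpose ?F) *v \<tau> c x"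
      by (simp add: tau matrix_vector_mul_assoc del: transpose_matrix_vector)
  qed
  assume zero: "\<forall>p j. j \<in> num -` {M+1..N} \<longrightarrow> \<Lambda> p $ j = 0"
  \<comment> \<open>The multipliers of the remaining forms vanish, so the first \<open>M\<close> terms are the full contraction.\<close>
  have force: "(\<Sum>j\<in>num -` {1..M}. \<Lambda> (param c x) $ j * \<Omega> j c x $ k)
      = ext_deriv (\<sigma> c) x (v c x) (axis k 1)" if "c \<in> \<A>" "x \<in> chart_ran c" for c x k
  proof -
    have "\<Lambda> (param c x) $ j = 0" if "j \<notin> num -` {1..M}" for j
    proof -
      have "num j \<in> {1..N}" using num by (auto simp: bij_betw_def)
      with that zero show ?thesis by auto
    qed
    then have "(\<Sum>j\<in>num -` {1..M}. \<Lambda> (param c x) $ j * \<Omega> j c x $ k)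
        = (\<Sum>j\<in>UNIV. \<Lambda> (param c x) $ j * \<Omega> j c x $ k)"
      by (intro sum.mono_neutral_left) auto
    then show ?thesis by (simp add: \<Lambda>_expansion[OF that] inner_axis)
  qed
  show "invariant_relation \<A> v (kinetic_energy G)
              (\<lambda>c x. \<chi> k. partial_deriv k (\<lambda>z. 1/2 * metric_sq G c z (v c z)) x
                           + (\<Sum>j\<in>num -` {1..M}. \<Lambda> (param c x) $ j * \<Omega> j c x $ k))"
    unfolding invariant_relation_def
  proof (intro allI impI)
    fix I \<gamma> assume sol: "first_order_solution \<A> v I \<gamma>"
    then have I: "open I" "is_interval I" "continuous_on I \<gamma>"
      and deriv: "\<And>c t. c \<in> \<A> \<Longrightarrow> t \<in> I \<Longrightarrow> \<gamma> t \<in> chart_dom c \<Longrightarrow>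
        ((coord c \<circ> \<gamma>) has_vector_derivative v c (coord c (\<gamma> t))) (at t)"
      unfolding first_order_solution_def by blast+
    show "lagrange_solution \<A> (kinetic_energy G)
              (\<lambda>c x. \<chi> k. partial_deriv k (\<lambda>z. 1/2 * metric_sq G c z (v c z)) x
                           + (\<Sum>j\<in>num -` {1..M}. \<Lambda> (param c x) $ j * \<Omega> j c x $ k)) I \<gamma>"
      unfolding lagrange_solution_def Let_def
    proof (intro conjI I ballI impI)
      fix c t assume c: "c \<in> \<A>" and t: "t \<in> I" "\<gamma> t \<in> chart_dom c"
      let ?x = "coord c \<circ> \<gamma>"
      let ?xdot = "\<lambda>s. vector_derivative ?x (at s)"
      have ran: "?x s \<in> chart_ran c" if "\<gamma> s \<in> chart_dom c" for s
        using that by (simp add: chart_ran_def)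
      have metric_c: "G c differentiable (at y)" "transpose (G c y) = G c y"
        if "y \<in> chart_ran c" for y
        using metric c that smooth_on_imp_differentiable[OF _ chart(2)[OF c] that, of "G c"]
        unfolding riemannian_metric_def by auto
      have v_c: "v c differentiable (at y)" if "y \<in> chart_ran c" for y
        unfolding v_def
        using det_vector_field_differentiable[OF atlas c that forms Upsilon_nonzero[OF c that] lam_smooth] .
      \<comment> \<open>The equation of motion is differentiated in time, so it is needed on a whole open set of
        times at which the curve lies in the chart.\<close>
      define S where "S = I \<inter> \<gamma> -` chart_dom c"
      have S: "open S" "t \<in> S"
        unfolding S_def using t continuous_open_preimage[OF I(3,1) chart(1)[OF c]] by auto
      have S_D: "s \<in> I" "\<gamma> s \<in> chart_dom c" if "s \<in> S" for s using that by (auto simp: S_def)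
      have vel: "(?x has_vector_derivative v c (?x s)) (at s)" "?xdot s = v c (?x s)" if "s \<in> S" for s
        using deriv[OF c S_D[OF that]] vector_derivative_at by (auto simp: o_def)
      show dx: "?x differentiable (at t)"
        using vel(1)[OF S(2)] by (auto simp: differentiable_def has_vector_derivative_def)
      have dv: "v c differentiable (at (?x t))" by (rule v_c[OF ran[OF t(2)]])
      have "(\<lambda>s. v c (?x s)) differentiable (at t)"
        using differentiable_chain_at[OF dx dv] by (simp add: o_def)
      then obtain D where "((\<lambda>s. v c (?x s)) has_derivative D) (at t)"
        unfolding differentiable_def by blast
      then have "(?xdot has_derivative D) (at t)"
        by (rule has_derivative_transform_within_open[OF _ S]) (simp add: vel(2))
      then show "?xdot differentiable (at t)" unfolding differentiable_def by blast
      show "\<forall>k. deriv (\<lambda>s. partial_deriv k (\<lambda>y. kinetic_energy G c (?x s) y) (?xdot s)) t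
                  - partial_deriv k (\<lambda>z. kinetic_energy G c z (?xdot t)) (?x t)
                = (\<chi> k. partial_deriv k (\<lambda>z. 1/2 * metric_sq G c z (v c z)) (?x t)
                   + (\<Sum>j\<in>num -` {1..M}. \<Lambda> (param c (?x t)) $ j * \<Omega> j c (?x t) $ k)) $ k"
      proof
        fix k
        have mom: "partial_deriv k (\<lambda>y. kinetic_energy G c (?x s) y) (?xdot s) = \<sigma> c (?x s) $ k"
          if "s \<in> S" for s
        proof -
          have sy: "transpose (G c (?x s)) = G c (?x s)"
            by (rule metric_c(2)[OF ran[OF S_D(2)[OF that]]])
          show ?thesis
            unfolding momentum_kinetic_energy[of G c "?x s", OF sy]
            by (simp only: \<sigma>_def lower_index_def vel(2)[OF that] vec_lambda_beta)
        qed
        have "deriv (\<lambda>s. partial_deriv k (\<lambda>y. kinetic_energy G c (?x s) y) (?xdot s)) t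
            = deriv (\<lambda>s. \<sigma> c (?x s) $ k) t"
          by (rule deriv_cong_ev[OF _ refl])
            (use eventually_nhds S mom in blast)
        also have "\<dots> = (\<Sum>j\<in>UNIV. partial_deriv j (\<lambda>z. \<sigma> c z $ k) (?x t) * v c (?x t) $ j)"
        proof (rule deriv_along_curve[OF _ vel(1)[OF S(2)]])
          show "(\<lambda>z. \<sigma> c z $ k) differentiable (at (?x t))"
            unfolding \<sigma>_def lower_index_def
            using metric_c(1)[OF ran[OF t(2)]] dv
            by (auto intro!: differentiable_sum differentiable_mult differentiable_vec_nth)
        qed
        finally show "deriv (\<lambda>s. partial_deriv k (\<lambda>y. kinetic_energy G c (?x s) y) (?xdot s)) t
                  - partial_deriv k (\<lambda>z. kinetic_energy G c z (?xdot t)) (?x t)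
                = (\<chi> k. partial_deriv k (\<lambda>z. 1/2 * metric_sq G c z (v c z)) (?x t)
                   + (\<Sum>j\<in>num -` {1..M}. \<Lambda> (param c (?x t)) $ j * \<Omega> j c (?x t) $ k)) $ k"
          using lagrange_identity[where G = G and c = c and x = "?x t" and v = v, OF metric_c(1)[OF ran[OF t(2)]] dv metric_c(2)[OF ran[OF t(2)]], of k]
          unfolding vel(2)[OF S(2)] \<sigma>_def[symmetric]
          by (simp only: force[OF c ran[OF t(2)]] vec_lambda_beta)
      qed
    qed
  qed
qed

end
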